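(* Let $A\in\mathbb R^{m\times n}$ with $m\le n$, let $\mathbf b\in\mathbb R^m$, and let $s\in\{1,\dots,m\}$. If there is $T\subseteq\{1,\dots,m\}$ with $|T|\ge m-s$ such that $A_T$ has full row rank, then the problem $$\min_{\mathbf x\in\mathbb R^n} f(\mathbf x)\quad\text{s.t.}\quad \|(A\mathbf x-\mathbf b)_+\|_0\le s$$ is feasible, i.e. there exists $\mathbf x\in\mathbb R^n$ with $\|(A\mathbf x-\mathbf b)_+\|_0\le s$.
   Context: $f:\mathbb R^n\to\mathbb R$ is continuously differentiable. $A_T$ is the submatrix of $A$ formed by the rows indexed by $T$. For $\mathbf u\in\mathbb R^m$, $\mathbf u_+$ is the entrywise positive part $\max\{u_i,0\}$ and $\|\cdot\|_0$ counts nonzero entries, so $\|\mathbf u_+\|_0$ is the number of positive entries of $\mathbf u$. *)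

theory Defs
  imports "HOL-Analysis.Analysis"
begin

definition continuously_differentiable :: "(real^'n \<Rightarrow> real) \<Rightarrow> bool" where
  "continuously_differentiable f \<longleftrightarrow>
     (\<exists>g. (\<forall>x. GDERIV f x :> g x) \<and> continuous_on UNIV g)"

definition pos_part :: "real^'m \<Rightarrow> real^'m" where
  "pos_part u = (\<chi> i. max (u $ i) 0)"

definition l0_norm :: "real^'m \<Rightarrow> nat" where
  "l0_norm u = card {i. u $ i \<noteq> 0}"

text \<open>
  The index set \<open>T\<close> varies (and may be empty), so the submatrix \<open>A\<^sub>T\<close> is not itself of a type
  \<open>real^'n^'k\<close>. It is represented by its rows, i.e. by \<open>row i A\<close> for \<open>i\<close> in \<open>T\<close>, and its row rank
  is the dimension of the space they span, as in \<open>row_rank_def\<close>.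
  Full row rank compares this with the number \<open>card T\<close> of row indices (not of distinct rows), so
  it fails if two indices in \<open>T\<close> carry the same row; for empty \<open>T\<close> it holds.
\<close>

definition submatrix_rows :: "real^'n^'m \<Rightarrow> 'm set \<Rightarrow> (real^'n) set" where
  "submatrix_rows A T = {row i A | i. i \<in> T}"

definition submatrix_row_rank :: "real^'n^'m \<Rightarrow> 'm set \<Rightarrow> nat" where
  "submatrix_row_rank A T = dim (submatrix_rows A T)"

definition submatrix_full_row_rank :: "real^'n^'m \<Rightarrow> 'm set \<Rightarrow> bool" where
  "submatrix_full_row_rank A T \<longleftrightarrow> submatrix_row_rank A T = card T"

lemma submatrix_row_rank_UNIV: "submatrix_row_rank A UNIV = rank A"
  by (simp add: submatrix_row_rank_def submatrix_rows_def row_rank_def rows_def)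

end

theory Submission
  imports Defs
begin

text \<open>
  Full row rank of \<open>A\<^sub>T\<close> makes the linear system \<open>A\<^sub>T x = b\<^sub>T\<close> solvable: the rows indexed by
  \<open>T\<close> are pairwise distinct and linearly independent, so some linear functional sends each of
  them to the prescribed entry of \<open>b\<close>, and every linear functional is the inner product with some
  vector \<open>x\<close>. At such a point \<open>A x - b\<close> vanishes on \<open>T\<close>, so its positive entries lie in the
  complement of \<open>T\<close>, which has at most \<open>s\<close> elements.
\<close>

text \<open>
  The rank is at most the number of distinct rows, which is at most \<open>card T\<close>. Equality of the
  two ends therefore excludes both repeated rows and a linear relation between them.
\<close>

lemma full_row_rank_imp_inj_independent:
  fixes A :: "real^'n^'m"
  assumes "submatrix_full_row_rank A T"
  shows "inj_on (\<lambda>i. row i A) T" and "independent ((\<lambda>i. row i A) ` T)"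
proof -
  let ?R = "(\<lambda>i. row i A) ` T"
  have dim: "dim ?R = card T"
    using assms
    by (simp add: submatrix_full_row_rank_def submatrix_row_rank_def submatrix_rows_def
        Setcompr_eq_image)
  have upper: "card ?R \<le> card T"
    by (rule card_image_le) simp
  have lower: "dim ?R \<le> card ?R"
    by (rule dim_le_card) (auto intro: span_base)
  show "inj_on (\<lambda>i. row i A) T"
    by (rule eq_card_imp_inj_on) (use dim upper lower in auto)
  show "independent ?R"
    by (rule card_le_dim_spanning[of _ ?R]) (use dim upper in \<open>auto intro: span_base\<close>)
qed

lemma independent_imp_inner_interpolation:
  fixes v :: "'i \<Rightarrow> 'a::euclidean_space" and c :: "'i \<Rightarrow> real"
  assumes "inj_on v T" and "independent (v ` T)"
  shows "\<exists>x. \<forall>i\<in>T. v i \<bullet> x = c i"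
proof -
  obtain g :: "'a \<Rightarrow> real"
    where lin: "linear g" and g: "\<forall>w\<in>v ` T. g w = c (inv_into T v w)"
    using linear_independent_extend[OF assms(2), of "\<lambda>w. c (inv_into T v w)"] by blast
  \<comment> \<open>Finite-dimensional Riesz representation: the adjoint of \<open>g\<close> at \<open>1\<close> represents \<open>g\<close>.\<close>
  have "v i \<bullet> adjoint g 1 = c i" if "i \<in> T" for i
  proof -
    have "v i \<bullet> adjoint g 1 = g (v i)"
      by (simp add: adjoint_works[OF lin])
    also have "\<dots> = c i"
      using that g assms(1) by (simp add: inv_into_f_f)
    finally show ?thesis .
  qed
  then show ?thesis
    by blast
qed

theorem theorem3p1:
  fixes f :: "real^'n \<Rightarrow> real"
    and A :: "real^'n^'m"
    and b :: "real^'m"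
    and s :: nat
  assumes "continuously_differentiable f"
    and "CARD('m) \<le> CARD('n)"
    and "s \<in> {1..CARD('m)}"
    and "\<exists>T :: 'm set. card T \<ge> CARD('m) - s \<and> submatrix_full_row_rank A T"
  shows "\<exists>x :: real^'n. l0_norm (pos_part (A *v x - b)) \<le> s"
proof -
  obtain T :: "'m set" where card_T: "card T \<ge> CARD('m) - s"
    and full: "submatrix_full_row_rank A T"
    using assms(4) by blast
  obtain x where x: "\<forall>i\<in>T. row i A \<bullet> x = b $ i"
    using independent_imp_inner_interpolation[OF full_row_rank_imp_inj_independent[OF full],
        of "\<lambda>i. b $ i"]
    by blast
  have "{i. pos_part (A *v x - b) $ i \<noteq> 0} \<subseteq> - T"
    using x by (auto simp: pos_part_def matrix_vector_mul_component row_def)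
  then have "l0_norm (pos_part (A *v x - b)) \<le> card (- T)"
    unfolding l0_norm_def by (intro card_mono) auto
  also have "\<dots> = CARD('m) - card T"
    by (simp add: Compl_eq_Diff_UNIV card_Diff_subset)
  also have "\<dots> \<le> s"
    using card_T by linarith
  finally show ?thesis
    by blast
qed

end
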